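(* Fix $t\in[0,1]$. Let $F$ be a distribution function with positive support (contained in $[0,\infty)$) that is absolutely continuous with respect to Lebesgue measure and strictly increasing, with inverse $F^{-1}:[0,1]\to[0,\infty)$. For each $n\ge1$ let $\tilde T_{(1)}\le\dots\le\tilde T_{(n)}$ be the order statistics of $n$ i.i.d. random variables with distribution $F$, and set $\tilde T_{(0)}:=0$. Then the sequence $\{\tilde T_{(\lfloor nt\rfloor)},\ n\ge1\}$ satisfies the large deviations principle (LDP) in $[0,\infty)$ with good rate function $$\tilde I_t(y):=\inf_{x\in[0,1]:\,F^{-1}(x)=y} I_t(x),\qquad I_t(x)=t\log\left(\frac tx\right)+(1-t)\log\left(\frac{1-t}{1-x}\right),$$ where the infimum over the empty set is $+\infty$.
   Context: A rate function on a Hausdorff topological space $\mathcal X$ is a lower semicontinuous map $I:\mathcal X\to[0,\infty]$; it is good if all its level sets $\{x: I(x)\le\alpha\}$, $\alpha\in[0,\infty)$, are compact. A sequence of random elements $\{X_n\}$ of $\mathcal X$ satisfies the LDP with rate function $I$ if $\liminf_{n\to\infty}\frac1n\log\mathbb P(X_n\in G)\ge-\inf_{x\in G}I(x)$ for every open $G\subset\mathcal X$ and $\limsup_{n\to\infty}\frac1n\log\mathbb P(X_n\in F)\le-\inf_{x\in F}I(x)$ for every closed $F\subset\mathcal X$. Conventions in $I_t$: a term with zero coefficient ($t=0$ or $1-t=0$) is $0$, and a term $c\log(c/0)$ with $c>0$ is $+\infty$. The inverse $F^{-1}$ is taken to map $[0,1]$ into $[0,\infty)$ (finite values).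
   Formalization: The case t = 0 is excluded because the claim fails there for every F: T_(0) = 0 surely, so P(T_(0) ∈ (0,∞)) = 0, while I_0(x) = −log(1−x) is finite on [0,1), which violates the LDP lower bound for G = (0,∞). *)

theory Defs
  imports "HOL-Probability.Probability"
begin

text \<open>Large deviations on a topological space \<open>S\<close>, given as an abstract topology so that
  the subspace \<open>[0,\<infinity>)\<close> of the real line is covered. Functions with values in \<open>[0,\<infinity>]\<close> are rendered
  as nonnegative functions into \<^typ>\<open>ereal\<close>, and only their values on \<open>topspace S\<close> matter.\<close>

definition rate_function :: "'b topology \<Rightarrow> ('b \<Rightarrow> ereal) \<Rightarrow> bool" where
  "rate_function S I \<longleftrightarrow> Hausdorff_space S \<and>
     (\<forall>x\<in>topspace S. 0 \<le> I x) \<and>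
     (\<forall>\<alpha>. openin S {x \<in> topspace S. \<alpha> < I x})"

definition good_rate_function :: "'b topology \<Rightarrow> ('b \<Rightarrow> ereal) \<Rightarrow> bool" where
  "good_rate_function S I \<longleftrightarrow> rate_function S I \<and>
     (\<forall>\<alpha>::real. 0 \<le> \<alpha> \<longrightarrow> compactin S {x \<in> topspace S. I x \<le> ereal \<alpha>})"

text \<open>Values outside \<open>S\<close> are tolerated on a null set: a random variable whose distribution is
  supported by \<open>[0,\<infinity>)\<close> is a random element of \<open>[0,\<infinity>)\<close> only almost surely.\<close>

definition random_element :: "'a measure \<Rightarrow> 'b topology \<Rightarrow> ('a \<Rightarrow> 'b) \<Rightarrow> bool" where
  "random_element M S X \<longleftrightarrow> prob_space M \<and> (AE \<omega> in M. X \<omega> \<in> topspace S) \<and>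
     (\<forall>U. openin S U \<longrightarrow> {\<omega> \<in> space M. X \<omega> \<in> U} \<in> sets M)"

text \<open>The real logarithm has \<open>ln 0 = 0\<close>, whereas large deviations need \<open>log 0 = -\<infinity>\<close>.\<close>

definition log_prob :: "real \<Rightarrow> ereal" where
  "log_prob p = (if p \<le> 0 then -\<infinity> else ereal (ln p))"

text \<open>The LDP only involves the laws of the \<open>X n\<close>, so each \<open>X n\<close> may live on its own probability
  space \<open>M n\<close>. Sequences start at \<open>n = 1\<close>.\<close>

definition satisfies_LDP ::
  "(nat \<Rightarrow> 'a measure) \<Rightarrow> 'b topology \<Rightarrow> (nat \<Rightarrow> 'a \<Rightarrow> 'b) \<Rightarrow> ('b \<Rightarrow> ereal) \<Rightarrow> bool" where
  "satisfies_LDP M S X I \<longleftrightarrow>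
     rate_function S I \<and>
     (\<forall>n\<ge>1. random_element (M n) S (X n)) \<and>
     (\<forall>G. openin S G \<longrightarrow>
        liminf (\<lambda>n. ereal (1 / real n) * log_prob (measure (M n) {\<omega> \<in> space (M n). X n \<omega> \<in> G}))
          \<ge> - (INF x\<in>G. I x)) \<and>
     (\<forall>C. closedin S C \<longrightarrow>
        limsup (\<lambda>n. ereal (1 / real n) * log_prob (measure (M n) {\<omega> \<in> space (M n). X n \<omega> \<in> C}))
          \<le> - (INF x\<in>C. I x))"

text \<open>The \<open>k\<close>-th smallest of \<open>x 1, \<dots>, x n\<close> (with multiplicity), for \<open>1 \<le> k \<le> n\<close>; zero for \<open>k = 0\<close>.\<close>

definition order_statistic :: "nat \<Rightarrow> (nat \<Rightarrow> real) \<Rightarrow> nat \<Rightarrow> real" where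
  "order_statistic n x k = (if k = 0 then 0 else sort (map x [1..<Suc n]) ! (k - 1))"

text \<open>The term \<open>c log (c / x)\<close> for \<open>c, x \<in> [0,1]\<close>, equal to \<open>0\<close> if \<open>c = 0\<close> and to \<open>\<infinity>\<close> if \<open>c > 0 = x\<close>.\<close>

definition entropy_term :: "real \<Rightarrow> real \<Rightarrow> ereal" where
  "entropy_term c x = (if c = 0 then 0 else if x = 0 then \<infinity> else ereal (c * ln (c / x)))"

definition I_rate :: "real \<Rightarrow> real \<Rightarrow> ereal" where
  "I_rate t x = entropy_term t x + entropy_term (1 - t) (1 - x)"

definition I_tilde :: "(real \<Rightarrow> real) \<Rightarrow> real \<Rightarrow> real \<Rightarrow> ereal" where
  "I_tilde Finv t y = (INF x\<in>{x\<in>{0..1}. Finv x = y}. I_rate t x)"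

text \<open>\<open>F\<close> is the distribution function of a law that is absolutely continuous with respect to
  Lebesgue measure.\<close>

definition abs_cont_distribution_function :: "(real \<Rightarrow> real) \<Rightarrow> bool" where
  "abs_cont_distribution_function F \<longleftrightarrow>
     (\<exists>\<mu>. real_distribution \<mu> \<and> absolutely_continuous lborel \<mu> \<and> F = cdf \<mu>)"

text \<open>\<open>F\<close> is strictly increasing with inverse \<open>Finv\<close> from \<open>[0,1]\<close> to \<open>[0,\<infinity>)\<close>. Since
  \<open>Finv 1\<close> is finite, \<open>F\<close> is constant beyond it (and before \<open>Finv 0\<close>), so strict monotonicity can
  only be meant on the interval \<open>[Finv 0, Finv 1]\<close>. Together with \<open>F (Finv u) = u\<close> it makes
  \<open>F\<close> and \<open>Finv\<close> mutually inverse bijections between that interval and \<open>[0,1]\<close>.\<close>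

definition strictly_increasing_with_inverse :: "(real \<Rightarrow> real) \<Rightarrow> (real \<Rightarrow> real) \<Rightarrow> bool" where
  "strictly_increasing_with_inverse F Finv \<longleftrightarrow>
     Finv \<in> {0..1} \<rightarrow> {0..} \<and>
     strict_mono_on {Finv 0..Finv 1} F \<and>
     (\<forall>u\<in>{0..1}. F (Finv u) = u)"

end

theory Submission
  imports Defs
begin

text \<open>The order statistic of rank \<open>k\<close> is at most \<open>y\<close> iff at least \<open>k\<close> of the sample points are at
  most \<open>y\<close>, and the number of such points is binomial with success probability \<open>F y\<close>. Summing
  over the random set of indices of these points, a change of the success probability from \<open>F y\<close> to
  \<open>t\<close> gives the exponential decay of both tails. For the lower bound at \<open>y\<close>, the order statistic lies in
  \<open>(u, y]\<close> as soon as exactly \<open>k\<close> points are at most \<open>y\<close> and not all of these are at most \<open>u\<close>; this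
  has probability at least \<open>(n choose k) (x^k - x'^k) (1 - x)^(n-k)\<close> with \<open>x = F y\<close> and \<open>x' = F u < x\<close>,
  whose exponential rate is that of the binomial weight, namely \<open>I_rate t x\<close>.\<close>

section \<open>Order statistics and binomial weights\<close>

text \<open>As \<open>P\<close> is downward closed, the entries satisfying it form a prefix of the
  sorted list. \<open>P\<close> is kept general because both \<open>u <= y\<close> and
  \<open>u < y\<close> are needed.\<close>

lemma sorted_nth_iff_length_filter:
  fixes xs :: "'a::linorder list"
  assumes "sorted xs" and "j < length xs" and "\<And>u v. u \<le> v \<Longrightarrow> P v \<Longrightarrow> P u"
  shows "P (xs ! j) \<longleftrightarrow> j < length (filter P xs)"
  using assms(1,2)
proof (induction xs arbitrary: j)
  case Nil
  then show ?case by simp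
next
  case (Cons a xs)
  show ?case
  proof (cases "P a")
    case True
    then show ?thesis using Cons by (cases j) auto
  next
    case False
    then have nP: "\<not> P x" if "x \<in> set (a # xs)" for x
      using that Cons.prems(1) assms(3) by auto
    then have "\<not> P ((a # xs) ! j)" using Cons.prems(2) nth_mem by blast
    moreover from nP have "filter P (a # xs) = []"
      by (simp only: filter_empty_conv not_False_eq_True) blast
    ultimately show ?thesis by simp
  qed
qed

lemma order_statistic_iff_card:
  assumes "1 \<le> k" and "k \<le> n" and "\<And>u v. u \<le> v \<Longrightarrow> P v \<Longrightarrow> P u"
  shows "P (order_statistic n x k) \<longleftrightarrow> k \<le> card {i \<in> {1..n}. P (x i)}"
proof -
  have "length (filter P (sort (map x [1..<Suc n]))) = length (filter P (map x [1..<Suc n]))"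
    by (metis mset_filter mset_sort size_mset)
  also have "\<dots> = length (filter (\<lambda>i. P (x i)) [1..<Suc n])"
    by (simp only: filter_map length_map o_def)
  also have "\<dots> = card (set (filter (\<lambda>i. P (x i)) [1..<Suc n]))"
    by (rule distinct_card[symmetric]) simp
  also have "set (filter (\<lambda>i. P (x i)) [1..<Suc n]) = {i \<in> {1..n}. P (x i)}"
    by auto
  finally show ?thesis
    using sorted_nth_iff_length_filter[of "sort (map x [1..<Suc n])" "k - 1" P] assms
    unfolding order_statistic_def by auto
qed

text \<open>The Poisson weight \<open>k^j / j!\<close> is largest at \<open>j = k\<close>:
  consecutive weights have ratio \<open>k / (j + 1)\<close>, which is at least 1 for
  \<open>j < k\<close> and below 1 afterwards. Cross-multiplied, the comparison stays in the natural
  numbers.\<close>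

lemma fact_mult_power_le: "fact k * k ^ j \<le> (fact j * k ^ k :: nat)"
proof (cases "j \<le> k")
  case True
  have "fact (j + d) \<le> fact j * (j + d) ^ d" for d
  proof (induction d)
    case (Suc d)
    have "fact (j + Suc d) = Suc (j + d) * fact (j + d)" by simp
    also have "\<dots> \<le> Suc (j + d) * (fact j * (j + d) ^ d)"
      by (rule mult_le_mono2) (rule Suc)
    also have "\<dots> \<le> Suc (j + d) * (fact j * Suc (j + d) ^ d)"
      by (intro mult_le_mono2 power_mono) auto
    finally show ?case by (simp add: mult_ac)
  qed simp
  from this[of "k - j"] have "fact k \<le> fact j * k ^ (k - j)"
    using True by simp
  then have "fact k * k ^ j \<le> fact j * k ^ (k - j) * k ^ j" by simp
  with True show ?thesis by (simp add: mult.assoc flip: power_add)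
next
  case False
  have "fact k * k ^ d \<le> (fact (k + d) :: nat)" for d
  proof (induction d)
    case (Suc d)
    have "fact k * k ^ Suc d = k * (fact k * k ^ d)" by simp
    also have "\<dots> \<le> Suc (k + d) * fact (k + d)" by (rule mult_le_mono) (use Suc in auto)
    finally show ?case by simp
  qed simp
  from this[of "j - k"] have "fact k * k ^ (j - k) * k ^ k \<le> fact j * k ^ k"
    using False by simp
  then show ?thesis using False by (simp add: mult.assoc flip: power_add)
qed

text \<open>The mode of the binomial distribution with parameters \<open>n\<close> and \<open>k / n\<close> is \<open>k\<close>, so its
  weight is at least the average weight.\<close>

lemma binomial_entropy_bound:
  assumes "k \<le> n"
  shows "n ^ n \<le> Suc n * ((n choose k) * k ^ k * (n - k) ^ (n - k))"
proof -
  have "(n choose j) * k ^ j * (n - k) ^ (n - j) \<le> (n choose k) * k ^ k * (n - k) ^ (n - k)"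
    if "j \<le> n" for j
  proof -
    \<comment> \<open>Multiplication by \<open>?f\<close> clears the denominators. Both sides then
      contain \<open>fact n\<close>, and what remains is a product of two Poisson comparisons, one
      for \<open>k\<close> and one for \<open>n - k\<close>.\<close>
    let ?f = "fact k * fact (n - k) * (fact j * fact (n - j)) :: nat"
    have "?f * ((n choose j) * k ^ j * (n - k) ^ (n - j))
        = (fact j * fact (n - j) * (n choose j)) * ((fact k * k ^ j) * (fact (n - k) * (n - k) ^ (n - j)))"
      by (simp only: mult_ac)
    also have "\<dots> = fact n * ((fact k * k ^ j) * (fact (n - k) * (n - k) ^ (n - j)))"
      using binomial_fact_lemma[OF that] by simp
    also have "\<dots> \<le> fact n * ((fact j * k ^ k) * (fact (n - j) * (n - k) ^ (n - k)))"
      by (intro mult_le_mono le_refl fact_mult_power_le)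
    also have "\<dots> = (fact k * fact (n - k) * (n choose k)) * ((fact j * k ^ k) * (fact (n - j) * (n - k) ^ (n - k)))"
      using binomial_fact_lemma[OF assms] by simp
    also have "\<dots> = ?f * ((n choose k) * k ^ k * (n - k) ^ (n - k))"
      by (simp only: mult_ac)
    finally show ?thesis by (simp only: nat_mult_le_cancel1[of ?f] fact_gt_zero nat_0_less_mult_iff)
  qed
  then have "(\<Sum>j\<le>n. (n choose j) * k ^ j * (n - k) ^ (n - j))
      \<le> (\<Sum>j\<le>n. (n choose k) * k ^ k * (n - k) ^ (n - k))"
    by (intro sum_mono) simp
  \<comment> \<open>This is the binomial expansion of \<open>(k + (n - k)) ^ n\<close>, which has
    \<open>n + 1\<close> terms.\<close>
  moreover have "n ^ n = (\<Sum>j\<le>n. (n choose j) * k ^ j * (n - k) ^ (n - j))"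
    using binomial[of k "n - k" n] assms by simp
  ultimately show ?thesis by simp
qed

section \<open>Order statistics of a finite sample\<close>

lemma disjoint_family_on_vimageI:
  assumes "\<And>i x. i \<in> I \<Longrightarrow> x \<in> A i \<Longrightarrow> f x = i"
  shows "disjoint_family_on A I"
  unfolding disjoint_family_on_def using assms by blast

locale iid_sample = prob_space M for M :: "'a measure" +
  fixes \<mu> :: "real measure" and n :: nat and T :: "nat \<Rightarrow> 'a \<Rightarrow> real"
  assumes n_pos: "n \<ge> 1"
    and indep: "indep_vars (\<lambda>_. borel) T {1..n}"
    and law: "\<And>i. i \<in> {1..n} \<Longrightarrow> distr M borel (T i) = \<mu>"
begin

lemma T_measurable [measurable]: "i \<in> {1..n} \<Longrightarrow> T i \<in> borel_measurable M"
  using indep by (simp add: indep_vars_def)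

lemma prob_space_law: "prob_space \<mu>"
  using prob_space_distr[of "T 1" borel] law[of 1] T_measurable[of 1] n_pos by simp

lemma sets_law: "sets \<mu> = sets borel"
  using law[of 1] n_pos by (metis atLeastAtMost_iff order_refl sets_distr)

lemma space_law: "space \<mu> = UNIV"
  using sets_eq_imp_space_eq[OF sets_law] by simp

text \<open>\<open>B\<close> and \<open>B'\<close> need not be complementary: the interval estimate
  combines \<open>{..u}\<close> with \<open>{y<..}\<close>, leaving out the gap between
  \<open>u\<close> and \<open>y\<close>.\<close>

definition split_event :: "real set \<Rightarrow> real set \<Rightarrow> nat set \<Rightarrow> 'a set" where
  "split_event B B' A =
     {\<omega> \<in> space M. (\<forall>i\<in>A. T i \<omega> \<in> B) \<and> (\<forall>i\<in>{1..n} - A. T i \<omega> \<in> B')}"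

lemma prob_split_event:
  assumes "A \<subseteq> {1..n}" and [measurable]: "B \<in> sets borel" "B' \<in> sets borel"
  shows "prob (split_event B B' A) = measure \<mu> B ^ card A * measure \<mu> B' ^ (n - card A)"
    and "split_event B B' A \<in> sets M"
proof -
  \<comment> \<open>\<open>S\<close> merges both conditions into one family over all of
    \<open>{1..n}\<close>, so that independence applies to a single intersection.\<close>
  define S where "S i = (if i \<in> A then B else B')" for i
  have fin: "finite A" using assms(1) finite_subset by blast
  have eq: "split_event B B' A = (\<Inter>i\<in>{1..n}. T i -` S i \<inter> space M)"
    using n_pos assms(1) by (fastforce simp: split_event_def S_def)
  have SB: "S i \<in> sets borel" for i by (simp add: S_def)
  have "prob (split_event B B' A) = (\<Prod>i\<in>{1..n}. prob (T i -` S i \<inter> space M))"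
    unfolding eq by (rule indep_varsD[OF indep]) (use n_pos SB in auto)
  also have "\<dots> = (\<Prod>i\<in>{1..n}. measure \<mu> (S i))"
  proof (rule prod.cong[OF refl])
    fix i assume "i \<in> {1..n}"
    then show "prob (T i -` S i \<inter> space M) = measure \<mu> (S i)"
      using measure_distr[of "T i" M borel "S i"] law[of i] SB by simp
  qed
  also have "\<dots> = (\<Prod>i\<in>A. measure \<mu> (S i)) * (\<Prod>i\<in>{1..n} - A. measure \<mu> (S i))"
    by (metis assms(1) finite_atLeastAtMost mult.commute prod.subset_diff)
  also have "\<dots> = measure \<mu> B ^ card A * measure \<mu> B' ^ card ({1..n} - A)"
    unfolding S_def by simp
  finally show "prob (split_event B B' A) = measure \<mu> B ^ card A * measure \<mu> B' ^ (n - card A)"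
    using fin assms(1) by (simp add: card_Diff_subset)
  show "split_event B B' A \<in> sets M"
    unfolding eq using n_pos SB
    by (intro sets.finite_INT measurable_sets[OF T_measurable]) auto
qed

text \<open>The event is partitioned according to the exact index set \<open>A\<close> of the points
  in \<open>B\<close>. Summing over sets instead of cardinalities keeps binomial coefficients out,
  and an arbitrary \<open>Q\<close> serves both tails as well as measurability.\<close>

lemma prob_card:
  assumes [measurable]: "B \<in> sets borel"
  shows "prob {\<omega> \<in> space M. Q (card {i \<in> {1..n}. T i \<omega> \<in> B})}
       = (\<Sum>A | A \<subseteq> {1..n} \<and> Q (card A). measure \<mu> B ^ card A * (1 - measure \<mu> B) ^ (n - card A))"
    and "{\<omega> \<in> space M. Q (card {i \<in> {1..n}. T i \<omega> \<in> B})} \<in> sets M"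
proof -
  interpret \<mu>: prob_space \<mu> by (rule prob_space_law)
  let ?\<A> = "{A. A \<subseteq> {1..n} \<and> Q (card A)}"
  have fin: "finite ?\<A>" by (rule finite_subset[of _ "Pow {1..n}"]) auto
  have iff: "\<omega> \<in> split_event B (- B) A \<longleftrightarrow> \<omega> \<in> space M \<and> {i \<in> {1..n}. T i \<omega> \<in> B} = A"
    if "A \<subseteq> {1..n}" for A \<omega>
    using that by (auto simp: split_event_def)
  have eq: "{\<omega> \<in> space M. Q (card {i \<in> {1..n}. T i \<omega> \<in> B})} = (\<Union>A\<in>?\<A>. split_event B (- B) A)"
  proof (intro set_eqI iffI)
    fix \<omega> assume "\<omega> \<in> {\<omega> \<in> space M. Q (card {i \<in> {1..n}. T i \<omega> \<in> B})}"
    then have "{i \<in> {1..n}. T i \<omega> \<in> B} \<in> ?\<A>" "\<omega> \<in> space M" by auto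
    then show "\<omega> \<in> (\<Union>A\<in>?\<A>. split_event B (- B) A)"
      using iff by blast
  next
    fix \<omega> assume "\<omega> \<in> (\<Union>A\<in>?\<A>. split_event B (- B) A)"
    then obtain A where "A \<subseteq> {1..n}" "Q (card A)" "\<omega> \<in> split_event B (- B) A" by auto
    then show "\<omega> \<in> {\<omega> \<in> space M. Q (card {i \<in> {1..n}. T i \<omega> \<in> B})}" using iff by auto
  qed
  have compl: "measure \<mu> (- B) = 1 - measure \<mu> B"
    using \<mu>.prob_compl[of B] by (simp add: sets_law space_law Compl_eq_Diff_UNIV)
  have "disjoint_family_on (split_event B (- B)) ?\<A>"
    by (rule disjoint_family_on_vimageI[where f = "\<lambda>\<omega>. {i \<in> {1..n}. T i \<omega> \<in> B}"]) (simp add: iff)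
  then have "prob (\<Union>A\<in>?\<A>. split_event B (- B) A) = (\<Sum>A\<in>?\<A>. prob (split_event B (- B) A))"
    using fin by (intro finite_measure_finite_Union) (auto intro!: prob_split_event(2))
  also have "\<dots> = (\<Sum>A\<in>?\<A>. measure \<mu> B ^ card A * (1 - measure \<mu> B) ^ (n - card A))"
    by (intro sum.cong[OF refl]) (simp add: prob_split_event compl)
  finally show "prob {\<omega> \<in> space M. Q (card {i \<in> {1..n}. T i \<omega> \<in> B})}
       = (\<Sum>A\<in>?\<A>. measure \<mu> B ^ card A * (1 - measure \<mu> B) ^ (n - card A))"
    unfolding eq .
  show "{\<omega> \<in> space M. Q (card {i \<in> {1..n}. T i \<omega> \<in> B})} \<in> sets M"
    unfolding eq using fin by (intro sets.finite_UN) (auto intro!: prob_split_event(2))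
qed

text \<open>Change of measure from success probability \<open>p\<close> to \<open>s\<close>: on the event, every binomial weight
  changes by at least the factor it has at \<open>k\<close>.\<close>

lemma prob_card_le:
  fixes s :: real and k :: nat and B :: "real set"
  defines "p \<equiv> measure \<mu> B"
  assumes B: "B \<in> sets borel" and s: "0 \<le> s" "s \<le> 1" and k: "k \<le> n"
    and Q: "\<And>j. j \<le> n \<Longrightarrow> Q j \<Longrightarrow> k \<le> j \<and> p \<le> s \<or> j \<le> k \<and> s \<le> p"
  shows "s ^ k * (1 - s) ^ (n - k) * prob {\<omega> \<in> space M. Q (card {i \<in> {1..n}. T i \<omega> \<in> B})}
       \<le> p ^ k * (1 - p) ^ (n - k)"
proof -
  interpret \<mu>: prob_space \<mu> by (rule prob_space_law)
  have p: "0 \<le> p" "p \<le> 1" by (auto simp: p_def)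
  let ?\<A> = "{A. A \<subseteq> {1..n} \<and> Q (card A)}"
  have weight: "s ^ k * (1 - s) ^ (n - k) * (p ^ j * (1 - p) ^ (n - j))
      \<le> p ^ k * (1 - p) ^ (n - k) * (s ^ j * (1 - s) ^ (n - j))"
    if j: "j \<le> n" and "Q j" for j
    using Q[OF that]
  proof
    assume kj: "k \<le> j \<and> p \<le> s"
    \<comment> \<open>After common powers are cancelled, the claim is the \<open>d\<close>-th power
      of \<open>(1 - s) * p <= (1 - p) * s\<close>, which holds for \<open>p <= s\<close>. The other
      case is symmetric.\<close>
    define d where "d = j - k"
    have d: "j = k + d" "n - k = (n - j) + d" using kj j by (auto simp: d_def)
    have "(1 - s) ^ d * p ^ d \<le> (1 - p) ^ d * s ^ d"
      using kj p s by (intro mult_mono power_mono) auto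
    then have "s ^ k * p ^ k * (1 - s) ^ (n - j) * (1 - p) ^ (n - j) * ((1 - s) ^ d * p ^ d)
       \<le> s ^ k * p ^ k * (1 - s) ^ (n - j) * (1 - p) ^ (n - j) * ((1 - p) ^ d * s ^ d)"
      using p s by (intro mult_left_mono) auto
    then show ?thesis unfolding d(2) unfolding d(1) power_add by (simp only: mult_ac)
  next
    assume kj: "j \<le> k \<and> s \<le> p"
    define d where "d = k - j"
    have d: "k = j + d" "n - j = (n - k) + d" using kj k by (auto simp: d_def)
    have "s ^ d * (1 - p) ^ d \<le> p ^ d * (1 - s) ^ d"
      using kj p s by (intro mult_mono power_mono) auto
    then have "s ^ j * p ^ j * (1 - s) ^ (n - k) * (1 - p) ^ (n - k) * (s ^ d * (1 - p) ^ d)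
       \<le> s ^ j * p ^ j * (1 - s) ^ (n - k) * (1 - p) ^ (n - k) * (p ^ d * (1 - s) ^ d)"
      using p s by (intro mult_left_mono) auto
    then show ?thesis unfolding d(2) unfolding d(1) power_add by (simp only: mult_ac)
  qed
  have cardle: "card A \<le> n" if "A \<subseteq> {1..n}" for A
    using card_mono[OF _ that] by simp
  have "s ^ k * (1 - s) ^ (n - k) * prob {\<omega> \<in> space M. Q (card {i \<in> {1..n}. T i \<omega> \<in> B})}
      = (\<Sum>A\<in>?\<A>. s ^ k * (1 - s) ^ (n - k) * (p ^ card A * (1 - p) ^ (n - card A)))"
    unfolding prob_card(1)[OF B] sum_distrib_left p_def ..
  also have "\<dots> \<le> (\<Sum>A\<in>?\<A>. p ^ k * (1 - p) ^ (n - k) * (s ^ card A * (1 - s) ^ (n - card A)))"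
    by (intro sum_mono weight cardle) auto
  \<comment> \<open>Over all subsets the weights with parameter \<open>s\<close> have total mass 1,
    being the expansion of a product of \<open>n\<close> factors \<open>s + (1 - s)\<close>.\<close>
  also have "\<dots> \<le> (\<Sum>A\<in>Pow {1..n}. p ^ k * (1 - p) ^ (n - k) * (s ^ card A * (1 - s) ^ (n - card A)))"
    using p s by (intro sum_mono2) auto
  also have "\<dots> = p ^ k * (1 - p) ^ (n - k) * (\<Sum>A\<in>Pow {1..n}. (\<Prod>i\<in>A. s) * (\<Prod>i\<in>{1..n} - A. 1 - s))"
    unfolding sum_distrib_left
    by (intro sum.cong[OF refl]) (auto simp: card_Diff_subset[OF finite_subset])
  also have "(\<Sum>A\<in>Pow {1..n}. (\<Prod>i\<in>A. s) * (\<Prod>i\<in>{1..n} - A. 1 - s)) = (\<Prod>i\<in>{1..n}. s + (1 - s))"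
    by (rule prod_add[symmetric]) simp
  finally show ?thesis by simp
qed

section \<open>Tail and interval probabilities of a single order statistic\<close>

lemma order_statistic_le_iff:
  assumes "1 \<le> k" "k \<le> n"
  shows "order_statistic n (\<lambda>i. T i \<omega>) k \<le> y \<longleftrightarrow> k \<le> card {i \<in> {1..n}. T i \<omega> \<in> {..y}}"
  using order_statistic_iff_card[OF assms, of "\<lambda>u. u \<le> y" "\<lambda>i. T i \<omega>"] by simp

lemma order_statistic_ge_iff:
  assumes "1 \<le> k" "k \<le> n"
  shows "y \<le> order_statistic n (\<lambda>i. T i \<omega>) k \<longleftrightarrow> card {i \<in> {1..n}. T i \<omega> \<in> {..<y}} < k"
  using order_statistic_iff_card[OF assms, of "\<lambda>u. u < y" "\<lambda>i. T i \<omega>"] by auto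

lemma order_statistic_measurable:
  assumes "k \<le> n"
  shows "(\<lambda>\<omega>. order_statistic n (\<lambda>i. T i \<omega>) k) \<in> borel_measurable M"
proof (cases "k = 0")
  case True
  then show ?thesis by (simp add: order_statistic_def)
next
  case False
  then have "1 \<le> k" by simp
  then show ?thesis
    unfolding borel_measurable_iff_le order_statistic_le_iff[OF \<open>1 \<le> k\<close> assms]
    by (intro allI prob_card(2)) simp
qed

text \<open>The parameter \<open>s\<close> stays free: \<open>s = t\<close> yields the exponential
  decay, and \<open>s = 1 / 2\<close> shows that a statistic of positive rank is almost surely
  positive. The factor on the left is not divided out because it can vanish.\<close>

lemma prob_order_statistic_le:
  fixes s c :: real and k :: nat
  defines "p \<equiv> measure \<mu> {..c}"
  assumes k: "1 \<le> k" "k \<le> n" and s: "p \<le> s" "s \<le> 1"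
  shows "s ^ k * (1 - s) ^ (n - k) * prob {\<omega> \<in> space M. order_statistic n (\<lambda>i. T i \<omega>) k \<le> c}
       \<le> p ^ k * (1 - p) ^ (n - k)"
proof -
  have "0 \<le> s" using s by (simp add: p_def) (meson measure_nonneg order_trans)
  then show ?thesis
    unfolding order_statistic_le_iff[OF k] p_def
    using k s by (intro prob_card_le) (auto simp: p_def)
qed

lemma prob_order_statistic_ge:
  fixes s c :: real and k :: nat
  defines "p \<equiv> measure \<mu> {..<c}"
  assumes k: "1 \<le> k" "k \<le> n" and s: "0 \<le> s" "s \<le> p"
  shows "s ^ k * (1 - s) ^ (n - k) * prob {\<omega> \<in> space M. c \<le> order_statistic n (\<lambda>i. T i \<omega>) k}
       \<le> p ^ k * (1 - p) ^ (n - k)"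
proof -
  interpret \<mu>: prob_space \<mu> by (rule prob_space_law)
  have "s \<le> 1" using s by (simp add: p_def) (meson \<mu>.prob_le_1 order_trans)
  then show ?thesis
    unfolding order_statistic_ge_iff[OF k] p_def
    using k s by (intro prob_card_le) (auto simp: p_def)
qed

text \<open>An index set with fewer than \<open>k \<le> n\<close> elements leaves a positive
  exponent on the factor \<open>1 - measure \<mu> {..<c} = 0\<close>. The change of measure gives no
  information here when \<open>s = 1\<close>.\<close>

lemma prob_order_statistic_ge_eq_0:
  assumes k: "1 \<le> k" "k \<le> n" and "measure \<mu> {..<c} = 1"
  shows "prob {\<omega> \<in> space M. c \<le> order_statistic n (\<lambda>i. T i \<omega>) k} = 0"
  unfolding order_statistic_ge_iff[OF k] using k assms(3)
  by (subst prob_card) (auto intro!: sum.neutral)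

lemma prob_order_statistic_interval_ge:
  fixes u y :: real and k :: nat
  defines "q \<equiv> measure \<mu> {..u}" and "p \<equiv> measure \<mu> {..y}"
  assumes k: "1 \<le> k" "k \<le> n" and "u \<le> y"
  shows "real (n choose k) * (p ^ k - q ^ k) * (1 - p) ^ (n - k)
       \<le> prob {\<omega> \<in> space M. u < order_statistic n (\<lambda>i. T i \<omega>) k \<and> order_statistic n (\<lambda>i. T i \<omega>) k \<le> y}"
    (is "_ \<le> prob ?E")
proof -
  interpret \<mu>: prob_space \<mu> by (rule prob_space_law)
  \<comment> \<open>On \<open>D A\<close> the points at most \<open>y\<close> are exactly those
    indexed by \<open>A\<close>, and at least one of them exceeds \<open>u\<close>; hence fewer than
    \<open>card A\<close> points are at most \<open>u\<close>.\<close>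
  define D where "D A = split_event {..y} {y<..} A - split_event {..u} {y<..} A" for A
  let ?\<A> = "{A. A \<subseteq> {1..n} \<and> card A = k}"
  have fin: "finite ?\<A>" by (rule finite_subset[of _ "Pow {1..n}"]) auto
  have compl: "measure \<mu> {y<..} = 1 - p"
    using \<mu>.prob_compl[of "{..y}"]
    by (simp add: sets_law space_law Compl_eq_Diff_UNIV[symmetric] p_def)
  have D_sets: "D A \<in> sets M" if "A \<in> ?\<A>" for A
    using that unfolding D_def by (intro sets.Diff prob_split_event(2)) auto
  have prob_D: "prob (D A) = (p ^ k - q ^ k) * (1 - p) ^ (n - k)" if "A \<in> ?\<A>" for A
  proof -
    have "split_event {..u} {y<..} A \<subseteq> split_event {..y} {y<..} A"
      using \<open>u \<le> y\<close> by (fastforce simp: split_event_def)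
    then have "prob (D A) = prob (split_event {..y} {y<..} A) - prob (split_event {..u} {y<..} A)"
      using that unfolding D_def by (intro finite_measure_Diff prob_split_event(2)) auto
    also have "\<dots> = p ^ k * (1 - p) ^ (n - k) - q ^ k * (1 - p) ^ (n - k)"
      using that by (simp add: prob_split_event compl p_def q_def)
    finally show ?thesis by (simp add: algebra_simps)
  qed
  have D_iff: "\<omega> \<in> space M \<and> {i \<in> {1..n}. T i \<omega> \<in> {..y}} = A" if "\<omega> \<in> D A" "A \<in> ?\<A>" for \<omega> A
  proof -
    have "\<omega> \<in> space M" "\<forall>i\<in>A. T i \<omega> \<le> y" "\<forall>i\<in>{1..n} - A. y < T i \<omega>"
      using that(1) by (auto simp: D_def split_event_def)
    moreover from this have "T i \<omega> \<le> y \<longleftrightarrow> i \<in> A" if "i \<in> {1..n}" for i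
      using that by (metis Diff_iff not_less)
    ultimately show ?thesis using that(2) by auto
  qed
  have "D A \<subseteq> ?E" if A: "A \<in> ?\<A>" for A
  proof
    fix \<omega> assume \<omega>: "\<omega> \<in> D A"
    note eq = D_iff[OF \<omega> A]
    have "\<omega> \<notin> split_event {..u} {y<..} A" "\<forall>i\<in>{1..n} - A. T i \<omega> \<in> {y<..}"
      using \<omega> by (auto simp: D_def split_event_def)
    then obtain i where i: "i \<in> A" "\<not> T i \<omega> \<le> u"
      using eq by (auto simp: split_event_def)
    have "{i \<in> {1..n}. T i \<omega> \<in> {..u}} \<subseteq> {i \<in> {1..n}. T i \<omega> \<in> {..y}}"
      using \<open>u \<le> y\<close> by auto
    then have "{i \<in> {1..n}. T i \<omega> \<in> {..u}} \<subset> A"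
      using eq i by auto
    then have "card {i \<in> {1..n}. T i \<omega> \<in> {..u}} < k"
      using A psubset_card_mono[of A] finite_subset[of A "{1..n}"] by auto
    moreover have "card {i \<in> {1..n}. T i \<omega> \<in> {..y}} = k" using eq A by auto
    ultimately show "\<omega> \<in> ?E"
      using eq order_statistic_le_iff[OF k] by (auto simp: not_le[symmetric] simp del: atMost_iff)
  qed
  then have sub: "(\<Union>A\<in>?\<A>. D A) \<subseteq> ?E" by blast
  have "disjoint_family_on D ?\<A>"
    by (rule disjoint_family_on_vimageI) (use D_iff in blast)
  then have "prob (\<Union>A\<in>?\<A>. D A) = (\<Sum>A\<in>?\<A>. prob (D A))"
    using fin D_sets by (intro finite_measure_finite_Union) auto
  also have "\<dots> = (\<Sum>A\<in>?\<A>. (p ^ k - q ^ k) * (1 - p) ^ (n - k))"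
    by (intro sum.cong[OF refl] prob_D)
  also have "\<dots> = real (n choose k) * (p ^ k - q ^ k) * (1 - p) ^ (n - k)"
    using n_subsets[of "{1..n}" k] by simp
  finally show ?thesis
    using finite_measure_mono[OF sub] order_statistic_measurable[OF k(2)] by simp
qed

end

section \<open>The rate function\<close>

text \<open>For \<open>t > 0\<close> the conditions on \<open>x\<close> describe where the rate is
  finite. At \<open>x = t = 1\<close> the default value \<open>ln 0 = 0\<close> does no harm, since
  its coefficient \<open>1 - t\<close> vanishes.\<close>

lemma I_rate_eq:
  assumes "0 < t" "t \<le> 1" "0 < x" "x \<le> 1" "x < 1 \<or> t = 1"
  shows "I_rate t x = ereal (t * (ln t - ln x) + (1 - t) * (ln (1 - t) - ln (1 - x)))"
  using assms unfolding I_rate_def entropy_term_def by (auto simp: ln_div zero_ereal_def)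

lemma I_rate_0: "0 < t \<Longrightarrow> I_rate t 0 = \<infinity>"
  by (simp add: I_rate_def entropy_term_def)

lemma I_rate_1: "t \<noteq> 1 \<Longrightarrow> I_rate t 1 = \<infinity>"
  by (simp add: I_rate_def entropy_term_def)

lemma I_rate_self: "0 < t \<Longrightarrow> t \<le> 1 \<Longrightarrow> I_rate t t = 0"
  by (subst I_rate_eq) auto

text \<open>This is \<open>ln z <= z - 1\<close> at \<open>z = x / c\<close>. When it is added up
  for \<open>(t, x)\<close> and \<open>(1 - t, 1 - x)\<close>, the left sides cancel, which gives
  the nonnegativity of relative entropy.\<close>

lemma mult_ln_diff_ge: "0 \<le> c \<Longrightarrow> 0 < x \<Longrightarrow> c - x \<le> c * (ln c - ln x)" for c x :: real
proof (cases "c = 0")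
  case False
  assume "0 \<le> c" "0 < x"
  with False have "ln (x / c) \<le> x / c - 1" by (intro ln_le_minus_one) auto
  with False \<open>0 \<le> c\<close> \<open>0 < x\<close> show ?thesis by (simp add: ln_div field_simps)
qed simp

lemma I_rate_nonneg:
  assumes "0 < t" "t \<le> 1" "x \<in> {0..1}"
  shows "0 \<le> I_rate t x"
proof -
  consider "x = 0" | "x = 1" "t \<noteq> 1" | "0 < x" "x < 1" | "x = 1" "t = 1" using assms by force
  then show ?thesis
  proof cases
    case 3
    then show ?thesis
      using assms mult_ln_diff_ge[of t x] mult_ln_diff_ge[of "1 - t" "1 - x"]
      by (subst I_rate_eq) auto
  qed (use assms in \<open>auto simp: I_rate_0 I_rate_1 I_rate_self\<close>)
qed

lemma entropy_term_ne_MInf: "entropy_term c x \<noteq> -\<infinity>"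
  by (simp add: entropy_term_def)

text \<open>For \<open>c > 0\<close> the value \<infinity> at 0 is the limit from the right, so the
  extended-valued function is continuous up to the boundary. Closedness of the sublevel sets of the
  rate rests on this.\<close>

lemma continuous_on_entropy_term:
  assumes "0 \<le> c"
  shows "continuous_on {0..} (entropy_term c)"
proof (cases "c = 0")
  case True
  then show ?thesis by (simp add: entropy_term_def)
next
  case False
  with assms have c: "0 < c" by simp
  show ?thesis
    unfolding continuous_on_def
  proof
    fix x :: real assume x: "x \<in> {0..}"
    show "(entropy_term c \<longlongrightarrow> entropy_term c x) (at x within {0..})"
    proof (cases "x = 0")
      case True
      have "eventually (\<lambda>z. ereal r < entropy_term c z) (at 0 within {0..})" for r
      proof -
        \<comment> \<open>The radius \<open>c * exp (- r / c)\<close> is the solution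
          \<open>z\<close> of \<open>c * ln (c / z) = r\<close>.\<close>
        have "entropy_term c z > ereal r" if "dist z 0 < c * exp (- r / c)" "z \<in> {0..}" for z
        proof (cases "z = 0")
          case False
          with that have z: "0 < z" "z < c * exp (- r / c)" by auto
          then have "ln z < ln (c * exp (- r / c))" using c by simp
          also have "\<dots> = ln c - r / c" using c by (simp add: ln_mult)
          finally have "r < c * (ln c - ln z)" using c by (simp add: field_simps)
          then show ?thesis using z c by (simp add: entropy_term_def ln_div)
        qed (use c in \<open>simp add: entropy_term_def\<close>)
        then show ?thesis
          unfolding eventually_at using c by (intro exI[of _ "c * exp (- r / c)"]) auto
      qed
      then show ?thesis
        using True c by (simp add: tendsto_PInfty entropy_term_def)
    next
      case False
      with x have "0 < x" by simp
      then have "((\<lambda>z. ereal (c * ln (c / z))) \<longlongrightarrow> ereal (c * ln (c / x))) (at x within {0..})"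
        using c by (intro tendsto_intros) auto
      moreover have "eventually (\<lambda>z. ereal (c * ln (c / z)) = entropy_term c z) (at x within {0..})"
        unfolding eventually_at using \<open>0 < x\<close> c
        by (intro exI[of _ x]) (auto simp: entropy_term_def dist_real_def)
      ultimately have "(entropy_term c \<longlongrightarrow> ereal (c * ln (c / x))) (at x within {0..})"
        by (rule Lim_transform_eventually)
      then show ?thesis
        using \<open>0 < x\<close> c by (simp add: entropy_term_def)
    qed
  qed
qed

lemma continuous_on_I_rate:
  assumes "0 \<le> t" "t \<le> 1"
  shows "continuous_on {0..1} (I_rate t)"
proof -
  have 1: "continuous_on {0..1} (entropy_term t)"
    by (rule continuous_on_subset[OF continuous_on_entropy_term]) (use assms in auto)
  have 2: "continuous_on {0..1} (\<lambda>x. entropy_term (1 - t) (1 - x))"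
    by (rule continuous_on_compose2[OF continuous_on_entropy_term, of _ _ "\<lambda>x. 1 - x"])
      (use assms in \<open>auto intro!: continuous_intros\<close>)
  show ?thesis
    \<comment> \<open>The sum never takes the form \<infinity> - \<infinity>, because no entropy
      term is -\<infinity>.\<close>
    using 1 2 unfolding continuous_on_def I_rate_def
    by (auto intro!: tendsto_add_ereal_nonneg simp: entropy_term_ne_MInf)
qed

section \<open>Exponential rates\<close>

lemma nat_floor_mult_le:
  assumes "0 \<le> t" "t \<le> 1"
  shows "nat \<lfloor>real n * t\<rfloor> \<le> n"
proof -
  have "real n * t \<le> real n" using assms by (simp add: mult_left_le)
  then show ?thesis by linarith
qed

lemma nat_floor_mult_div_tendsto:
  assumes "0 \<le> t"
  shows "(\<lambda>n. real (nat \<lfloor>real n * t\<rfloor>) / real n) \<longlonglongrightarrow> t"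
proof (rule tendsto_sandwich)
  show "\<forall>\<^sub>F n in sequentially. t - 1 / real n \<le> real (nat \<lfloor>real n * t\<rfloor>) / real n"
    using eventually_gt_at_top[of 0]
  proof eventually_elim
    case (elim n)
    have "real n * t - 1 \<le> real (nat \<lfloor>real n * t\<rfloor>)" using assms by linarith
    then have "(real n * t - 1) / real n \<le> real (nat \<lfloor>real n * t\<rfloor>) / real n"
      by (rule divide_right_mono) simp
    then show ?case using elim by (simp add: diff_divide_distrib)
  qed
  show "\<forall>\<^sub>F n in sequentially. real (nat \<lfloor>real n * t\<rfloor>) / real n \<le> t"
    using eventually_gt_at_top[of 0]
  proof eventually_elim
    case (elim n)
    have "real (nat \<lfloor>real n * t\<rfloor>) \<le> real n * t" using assms by (simp add: of_nat_floor)
    then show ?case using elim by (simp add: field_simps)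
  qed
  show "(\<lambda>n. t - 1 / real n) \<longlonglongrightarrow> t"
    using tendsto_diff[OF tendsto_const[of t] lim_1_over_n] by simp
qed simp

lemma eventually_nat_floor_mult_ge_1:
  assumes "0 < t"
  shows "\<forall>\<^sub>F n in sequentially. 1 \<le> nat \<lfloor>real n * t\<rfloor>"
proof -
  have "\<forall>\<^sub>F n in sequentially. 1 / t \<le> real n"
    using filterlim_real_sequentially by (simp add: filterlim_at_top)
  then show ?thesis
  proof eventually_elim
    case (elim n)
    then have "1 \<le> real n * t" using assms by (simp add: field_simps)
    then show ?case by linarith
  qed
qed

lemma power_eq_exp_ln: "0 < x \<or> m = 0 \<Longrightarrow> x ^ m = exp (real m * ln x)" for x :: real
  by (auto simp: exp_of_nat_mult)

text \<open>The weight for \<open>p\<close> divided by the weight for \<open>t\<close> is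
  \<open>exp (n * L n)\<close> with \<open>L n\<close> tending to \<open>- I_rate t p\<close>; any
  \<open>r\<close> strictly below \<open>I_rate t p\<close> therefore works for large
  \<open>n\<close>.\<close>

lemma eventually_le_exp_of_change_of_measure:
  fixes t p r :: real and P :: "nat \<Rightarrow> real"
  assumes t: "0 < t" "t \<le> 1" and p: "0 < p" "p < 1" and r: "ereal r < I_rate t p"
    and P: "\<forall>\<^sub>F n in sequentially.
      t ^ nat \<lfloor>real n * t\<rfloor> * (1 - t) ^ (n - nat \<lfloor>real n * t\<rfloor>) * P n
      \<le> p ^ nat \<lfloor>real n * t\<rfloor> * (1 - p) ^ (n - nat \<lfloor>real n * t\<rfloor>)"
  shows "\<forall>\<^sub>F n in sequentially. P n \<le> exp (- (real n * r))"
proof -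
  define k where "k n = nat \<lfloor>real n * t\<rfloor>" for n :: nat
  have k_le: "k n \<le> n" for n unfolding k_def using t by (intro nat_floor_mult_le) auto
  have k_lim: "(\<lambda>n. real (k n) / real n) \<longlonglongrightarrow> t"
    unfolding k_def using t by (intro nat_floor_mult_div_tendsto) auto
  define L where "L n = real (k n) / real n * (ln p - ln t)
    + (1 - real (k n) / real n) * (ln (1 - p) - ln (1 - t))" for n
  have "L \<longlonglongrightarrow> t * (ln p - ln t) + (1 - t) * (ln (1 - p) - ln (1 - t))"
    unfolding L_def by (intro tendsto_intros k_lim)
  moreover have "t * (ln p - ln t) + (1 - t) * (ln (1 - p) - ln (1 - t)) < - r"
    using r p t by (subst (asm) I_rate_eq) (auto simp: algebra_simps)
  ultimately have "\<forall>\<^sub>F n in sequentially. L n < - r" by (rule order_tendstoD)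
  then show ?thesis
    using P eventually_gt_at_top[of 0]
  proof eventually_elim
    case (elim n)
    \<comment> \<open>For \<open>t = 1\<close> the rank equals \<open>n\<close>, so
      \<open>(1 - t) ^ (n - k n)\<close> is \<open>0 ^ 0 = 1\<close> and still agrees with its
      exponential form.\<close>
    have t1: "0 < 1 - t \<or> n - k n = 0"
      using t by (cases "t = 1") (auto simp: k_def)
    let ?e = "real (k n) * ln t + real (n - k n) * ln (1 - t)"
    have eq: "x ^ k n * (1 - x) ^ (n - k n) = exp (real (k n) * ln x + real (n - k n) * ln (1 - x))"
      if "0 < x" "0 < 1 - x \<or> n - k n = 0" for x
      using that power_eq_exp_ln[of x "k n"] power_eq_exp_ln[of "1 - x" "n - k n"]
      by (simp add: exp_add)
    have "exp ?e * P n \<le> exp (real (k n) * ln p + real (n - k n) * ln (1 - p))"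
      using elim(2) eq[of t] eq[of p] t1 t p by (simp flip: k_def)
    also have "\<dots> = exp ?e * exp (real n * L n)"
      using elim(3) k_le[of n] unfolding exp_add[symmetric] L_def
      by (simp add: of_nat_diff field_simps)
    finally have "P n \<le> exp (real n * L n)" by simp
    also have "\<dots> \<le> exp (- (real n * r))"
      using elim(1,3) mult_left_mono[of "L n" "- r" "real n"] by simp
    finally show ?case .
  qed
qed

lemma liminf_log_prob_ge:
  assumes "\<forall>\<^sub>F n in sequentially. exp (real n * L n) \<le> P n" and "L \<longlonglongrightarrow> l"
  shows "ereal l \<le> liminf (\<lambda>n. ereal (1 / real n) * log_prob (P n))"
proof -
  have "liminf (\<lambda>n. ereal (L n)) = ereal l"
    using assms(2) by (intro lim_imp_Liminf) auto
  moreover have "\<forall>\<^sub>F n in sequentially. ereal (L n) \<le> ereal (1 / real n) * log_prob (P n)"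
    using assms(1) eventually_gt_at_top[of 0]
  proof eventually_elim
    case (elim n)
    have pos: "0 < P n" using elim(1) exp_gt_zero less_le_trans by blast
    then have "real n * L n \<le> ln (P n)" using elim(1) by (simp add: ln_ge_iff)
    then show ?case using pos elim(2) by (simp add: log_prob_def field_simps)
  qed
  ultimately show ?thesis using Liminf_mono[of "\<lambda>n. ereal (L n)"] by metis
qed

lemma limsup_log_prob_le:
  assumes "\<forall>\<^sub>F n in sequentially. P n \<le> exp (- (real n * r))"
  shows "limsup (\<lambda>n. ereal (1 / real n) * log_prob (P n)) \<le> - ereal r"
proof (rule Limsup_bounded)
  show "\<forall>\<^sub>F n in sequentially. ereal (1 / real n) * log_prob (P n) \<le> - ereal r"
    using assms eventually_gt_at_top[of 0]
  proof eventually_elim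
    case (elim n)
    show ?case
    proof (cases "P n \<le> 0")
      case False
      then have "ln (P n) \<le> - (real n * r)" using elim(1) by (metis ln_exp ln_mono not_le)
      then show ?thesis using False elim(2) by (simp add: log_prob_def field_simps)
    qed (use elim in \<open>simp add: log_prob_def\<close>)
  qed
qed

text \<open>By \<open>binomial_entropy_bound\<close>, the binomial weight at \<open>k n\<close> with
  parameter \<open>s n = k n / n\<close> is at least \<open>1 / (n + 1)\<close>. This factor and the
  constant \<open>c\<close> disappear on the scale \<open>1 / n\<close>.\<close>

lemma liminf_log_prob_ge_binomial:
  fixes t x c :: real and P :: "nat \<Rightarrow> real"
  assumes t: "0 < t" "t \<le> 1" and x: "0 < x" "x \<le> 1" "x < 1 \<or> t = 1" and c: "0 < c"
    and P: "\<forall>\<^sub>F n in sequentially.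
      real (n choose nat \<lfloor>real n * t\<rfloor>) * (c * x ^ nat \<lfloor>real n * t\<rfloor>) * (1 - x) ^ (n - nat \<lfloor>real n * t\<rfloor>) \<le> P n"
  shows "- I_rate t x \<le> liminf (\<lambda>n. ereal (1 / real n) * log_prob (P n))"
proof -
  define k where "k n = nat \<lfloor>real n * t\<rfloor>" for n :: nat
  define s where "s n = real (k n) / real n" for n
  have k_le: "k n \<le> n" for n unfolding k_def using t by (intro nat_floor_mult_le) auto
  have s_lim: "s \<longlonglongrightarrow> t"
    unfolding s_def k_def using t by (intro nat_floor_mult_div_tendsto) auto
  \<comment> \<open>\<open>exp (n * L n)\<close> is the lower bound in the hypothesis on
    \<open>P\<close>, with the binomial coefficient replaced by
    \<open>1 / (2 * n * s n ^ k n * (1 - s n) ^ (n - k n))\<close>.\<close>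
  define L where "L n = ln c / real n - ln 2 / real n - ln (real n) / real n
     - s n * ln (s n) - (1 - s n) * ln (1 - s n) + s n * ln x + (1 - s n) * ln (1 - x)" for n
  have "(\<lambda>n. (1 - s n) * ln (1 - s n)) \<longlonglongrightarrow> (1 - t) * ln (1 - t)"
  \<comment> \<open>Continuity of the logarithm fails at \<open>t = 1\<close>, where
    \<open>1 - s n\<close> would have limit 0; there \<open>k n = n\<close> makes the term exactly
    0.\<close>
  proof (cases "t = 1")
    case True
    then have "(1 - s n) * ln (1 - s n) = 0" if "n > 0" for n
      using that by (simp add: s_def k_def)
    then show ?thesis
      by (intro tendsto_eventually eventually_mono[OF eventually_gt_at_top[of 0]]) (simp add: True)
  qed (use t in \<open>auto intro!: tendsto_intros s_lim\<close>)
  note s_compl_lim = this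
  have "L \<longlonglongrightarrow> 0 - 0 - 0 - t * ln t - (1 - t) * ln (1 - t) + t * ln x + (1 - t) * ln (1 - x)"
    unfolding L_def using t
    by (intro tendsto_add tendsto_diff s_compl_lim tendsto_mult tendsto_ln tendsto_const s_lim
        lim_const_over_n lim_ln_over_n) auto
  moreover have "\<forall>\<^sub>F n in sequentially. exp (real n * L n) \<le> P n"
    using P eventually_gt_at_top[of 0] eventually_nat_floor_mult_ge_1[OF t(1)]
  proof eventually_elim
    case (elim n)
    let ?m = "n - k n" and ?C = "real (n choose k n)"
    have k1: "0 < k n" using elim(3) unfolding k_def by linarith
    have x1: "0 < 1 - x \<or> ?m = 0"
      using x by (cases "t = 1") (auto simp: k_def)
    have s: "0 < s n" "real n * s n = real (k n)" "real n * (1 - s n) = real ?m"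
      using elim(2) k1 k_le[of n] by (auto simp: s_def field_simps of_nat_diff)
    have m1: "0 < 1 - s n \<or> ?m = 0" 
      using s(3) elim(2) by (metis gr0I of_nat_0_less_iff zero_less_mult_pos)
    have "real n * L n = ln c - ln 2 - ln (real n) - (real n * s n) * ln (s n)
        - (real n * (1 - s n)) * ln (1 - s n) + (real n * s n) * ln x + (real n * (1 - s n)) * ln (1 - x)"
      using elim(2) by (simp add: L_def field_simps)
    then have nL: "real n * L n = ln c - ln (2 * real n) - real (k n) * ln (s n)
        - real ?m * ln (1 - s n) + real (k n) * ln x + real ?m * ln (1 - x)"
      using elim(2) unfolding s by (simp add: ln_mult)
    have e: "exp (real (k n) * ln x) = x ^ k n" "exp (real ?m * ln (1 - x)) = (1 - x) ^ ?m"
        "exp (real (k n) * ln (s n)) = s n ^ k n" "exp (real ?m * ln (1 - s n)) = (1 - s n) ^ ?m"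
      by (rule power_eq_exp_ln[symmetric], use x(1) x1 s(1) m1 in blast)+
    have "exp (real n * L n) = c / (2 * real n * s n ^ k n * (1 - s n) ^ ?m) * x ^ k n * (1 - x) ^ ?m"
      unfolding nL exp_add exp_diff e using c elim(2) by (simp add: mult_ac)
    also have "\<dots> \<le> c * ?C * x ^ k n * (1 - x) ^ ?m"
    proof -
      have "real (n ^ n) \<le> real (Suc n * ((n choose k n) * k n ^ k n * ?m ^ ?m))"
        by (rule of_nat_mono[OF binomial_entropy_bound[OF k_le]])
      also have "\<dots> = real (Suc n) * (?C * (real n * s n) ^ k n * (real n * (1 - s n)) ^ ?m)"
        by (simp only: s of_nat_mult of_nat_power)
      also have "\<dots> = real (Suc n) * ?C * s n ^ k n * (1 - s n) ^ ?m * (real n ^ k n * real n ^ ?m)"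
        by (simp add: power_mult_distrib)
      also have "real n ^ k n * real n ^ ?m = real n ^ n"
        using k_le[of n] by (simp flip: power_add)
      finally have "1 \<le> real (Suc n) * ?C * s n ^ k n * (1 - s n) ^ ?m"
        using elim(2) by simp
      \<comment> \<open>Bounding \<open>n + 1\<close> by \<open>2 * n\<close> gives a product whose
        logarithm splits into the terms of \<open>L\<close>.\<close>
      also have "\<dots> \<le> 2 * real n * ?C * s n ^ k n * (1 - s n) ^ ?m"
        using elim(2) s m1 by (intro mult_right_mono) auto
      finally have *: "1 \<le> ?C * (2 * real n * s n ^ k n * (1 - s n) ^ ?m)" by (simp add: mult_ac)
      moreover have "0 < 2 * real n * s n ^ k n * (1 - s n) ^ ?m"
        using elim(2) s m1 by auto
      ultimately have "1 / (2 * real n * s n ^ k n * (1 - s n) ^ ?m) \<le> ?C"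
        by (simp add: divide_le_eq)
      then have "c * (1 / (2 * real n * s n ^ k n * (1 - s n) ^ ?m)) * (x ^ k n * (1 - x) ^ ?m)
          \<le> c * ?C * (x ^ k n * (1 - x) ^ ?m)"
        using c x by (intro mult_right_mono mult_left_mono) auto
      then show ?thesis by (simp add: mult_ac)
    qed
    also have "\<dots> \<le> P n" using elim(1) unfolding k_def by (simp add: mult_ac)
    finally show ?case .
  qed
  ultimately have "ereal (0 - 0 - 0 - t * ln t - (1 - t) * ln (1 - t) + t * ln x + (1 - t) * ln (1 - x))
      \<le> liminf (\<lambda>n. ereal (1 / real n) * log_prob (P n))"
    by (intro liminf_log_prob_ge)
  then show ?thesis using I_rate_eq[OF t x] by (simp add: algebra_simps)
qed

section \<open>The large deviations principle\<close>

text \<open>\<open>no_atoms\<close> is what absolute continuity provides: it makes \<open>F\<close>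
  continuous and gives \<open>{..<x}\<close> and \<open>{..x}\<close> the same mass.\<close>

locale continuous_quantile =
  fixes F Finv :: "real \<Rightarrow> real" and \<mu> :: "real measure" and t :: real
  assumes t_pos: "0 < t" and t_le_1: "t \<le> 1"
    and real_distribution: "real_distribution \<mu>"
    and F_eq_cdf: "F = cdf \<mu>"
    and no_atoms: "\<And>x. measure \<mu> {x} = 0"
    and F_neg: "\<And>x. x < 0 \<Longrightarrow> F x = 0"
    and inverse: "strictly_increasing_with_inverse F Finv"
begin

sublocale \<mu>: real_distribution \<mu> by (rule real_distribution)

lemma isCont_F: "isCont F x"
  unfolding F_eq_cdf \<mu>.isCont_cdf by (rule no_atoms)

lemma F_mono: "x \<le> y \<Longrightarrow> F x \<le> F y"
  unfolding F_eq_cdf by (rule \<mu>.cdf_nondecreasing)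

lemma F_nonneg: "0 \<le> F x"
  unfolding F_eq_cdf by (rule \<mu>.cdf_nonneg)

lemma F_le_1: "F x \<le> 1"
  unfolding F_eq_cdf by (rule \<mu>.cdf_bounded_prob)

lemma measure_atMost: "measure \<mu> {..x} = F x"
  by (simp add: F_eq_cdf cdf_def)

lemma measure_lessThan: "measure \<mu> {..<x} = F x"
proof -
  have "measure \<mu> ({..<x} \<union> {x}) = measure \<mu> {..<x} + measure \<mu> {x}"
    by (rule \<mu>.finite_measure_Union) auto
  moreover have "{..<x} \<union> {x} = {..x}" by auto
  ultimately show ?thesis using no_atoms[of x] by (simp add: measure_atMost)
qed

lemma F_0: "F 0 = 0"
proof (rule tendsto_unique)
  show "(F \<longlongrightarrow> F 0) (at_left 0)"
    using isCont_F[of 0] by (simp add: isCont_def filterlim_at_split)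
  show "(F \<longlongrightarrow> 0) (at_left 0)"
    by (rule tendsto_eventually) (auto simp: eventually_at_filter F_neg)
qed simp

lemma F_Finv: "u \<in> {0..1} \<Longrightarrow> F (Finv u) = u"
  using inverse by (simp add: strictly_increasing_with_inverse_def)

lemma Finv_nonneg: "u \<in> {0..1} \<Longrightarrow> 0 \<le> Finv u"
  using inverse by (auto simp: strictly_increasing_with_inverse_def)

lemma F_strict_mono: "strict_mono_on {Finv 0..Finv 1} F"
  using inverse by (simp add: strictly_increasing_with_inverse_def)

lemma F_below: "y \<le> Finv 0 \<Longrightarrow> F y = 0"
  using F_mono[of y "Finv 0"] F_nonneg[of y] F_Finv[of 0] by simp

lemma F_above: "Finv 1 \<le> y \<Longrightarrow> F y = 1"
  using F_mono[of "Finv 1" y] F_le_1[of y] F_Finv[of 1] by simp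

text \<open>\<open>F\<close> is 0 up to \<open>Finv 0\<close> and 1 from \<open>Finv 1\<close> on,
  so a value strictly between 0 and 1 can only be taken between these points.\<close>

lemma Finv_in: "u \<in> {0..1} \<Longrightarrow> Finv u \<in> {Finv 0..Finv 1}"
  using F_below[of "Finv u"] F_above[of "Finv u"] F_Finv[of u] by (cases "u = 0"; cases "u = 1") force+

lemma Finv_F: "y \<in> {Finv 0..Finv 1} \<Longrightarrow> Finv (F y) = y"
  using strict_mono_on_imp_inj_on[OF F_strict_mono] F_Finv[of "F y"] Finv_in[of "F y"]
  by (auto simp: inj_on_def F_nonneg F_le_1)

text \<open>The fibre of \<open>Finv\<close> over \<open>y\<close> is a singleton or empty, so the
  infimum disappears.\<close>

lemma I_tilde_eq:
  "I_tilde Finv t y = (if y \<in> {Finv 0..Finv 1} then I_rate t (F y) else \<infinity>)"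
proof (cases "y \<in> {Finv 0..Finv 1}")
  case True
  then have "{x \<in> {0..1}. Finv x = y} = {F y}"
    using Finv_F F_Finv F_nonneg F_le_1 by auto
  then show ?thesis using True by (simp add: I_tilde_def)
next
  case False
  then have *: "{x \<in> {0..1}. Finv x = y} = {}" using Finv_in by blast
  then show ?thesis unfolding I_tilde_def * using False by (auto simp: top_ereal_def)
qed

lemma I_tilde_nonneg: "0 \<le> I_tilde Finv t y"
  using I_rate_nonneg[OF t_pos t_le_1] by (simp add: I_tilde_eq F_nonneg F_le_1)

lemma compact_sublevel:
  assumes "\<alpha> < \<infinity>"
  shows "compact {y \<in> {0..}. I_tilde Finv t y \<le> \<alpha>}"
proof -
  have cont: "continuous_on {Finv 0..Finv 1} F"
    by (simp add: continuous_at_imp_continuous_on isCont_F)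
  have "continuous_on {Finv 0..Finv 1} (\<lambda>y. I_rate t (F y))"
    by (rule continuous_on_compose2[OF continuous_on_I_rate cont])
      (use t_pos t_le_1 F_nonneg F_le_1 in auto)
  then have "closed ({Finv 0..Finv 1} \<inter> (\<lambda>y. I_rate t (F y)) -` {..\<alpha>})"
    by (rule continuous_closed_preimage) auto
  then have "compact ({Finv 0..Finv 1} \<inter> ({Finv 0..Finv 1} \<inter> (\<lambda>y. I_rate t (F y)) -` {..\<alpha>}))"
    by (rule compact_Int_closed[OF compact_Icc])
  also have "{Finv 0..Finv 1} \<inter> ({Finv 0..Finv 1} \<inter> (\<lambda>y. I_rate t (F y)) -` {..\<alpha>})
      = {y \<in> {0..}. I_tilde Finv t y \<le> \<alpha>}"
    using assms Finv_nonneg[of 0] by (auto simp: I_tilde_eq)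
  finally show ?thesis .
qed

lemma rate_function_I_tilde: "rate_function (top_of_set {0..}) (I_tilde Finv t)"
proof -
  have "openin (top_of_set {0..}) {y \<in> {0..}. \<alpha> < I_tilde Finv t y}" for \<alpha>
  proof (cases "\<alpha> = \<infinity>")
    case False
    then have "closed {y \<in> {0..}. I_tilde Finv t y \<le> \<alpha>}"
      by (intro compact_imp_closed compact_sublevel) simp
    then have "open (- {y \<in> {0..}. I_tilde Finv t y \<le> \<alpha>})" by (rule open_Compl)
    moreover have "{y \<in> {0..}. \<alpha> < I_tilde Finv t y} = {0..} \<inter> - {y \<in> {0..}. I_tilde Finv t y \<le> \<alpha>}"
      by auto
    ultimately show ?thesis by (metis openin_open_Int)
  qed simp
  then show ?thesis
    by (auto simp: rate_function_def I_tilde_nonneg intro: Hausdorff_space_subtopology)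
qed

lemma good_rate_function_I_tilde: "good_rate_function (top_of_set {0..}) (I_tilde Finv t)"
  using rate_function_I_tilde compact_sublevel
  by (auto simp: good_rate_function_def compactin_subtopology)

end

section \<open>The sequence of order statistics of rank \<open>k n\<close>\<close>

locale order_statistic_LDP = continuous_quantile F Finv \<mu> t
  for F Finv :: "real \<Rightarrow> real" and \<mu> :: "real measure" and t :: real +
  fixes M :: "nat \<Rightarrow> 'a measure" and T :: "nat \<Rightarrow> nat \<Rightarrow> 'a \<Rightarrow> real"
  assumes iid: "\<And>n. n \<ge> 1 \<Longrightarrow> iid_sample (M n) \<mu> n (T n)"
begin

definition k :: "nat \<Rightarrow> nat" where "k n = nat \<lfloor>real n * t\<rfloor>"

definition X :: "nat \<Rightarrow> 'a \<Rightarrow> real" where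
  "X n \<omega> = order_statistic n (\<lambda>i. T n i \<omega>) (k n)"

lemma k_le: "k n \<le> n"
  unfolding k_def using t_pos t_le_1 by (intro nat_floor_mult_le) auto

lemma eventually_k_ge_1: "\<forall>\<^sub>F n in sequentially. 1 \<le> k n \<and> 1 \<le> n"
  unfolding k_def using eventually_nat_floor_mult_ge_1[OF t_pos] eventually_ge_at_top[of 1]
  by eventually_elim auto

lemma X_measurable: "n \<ge> 1 \<Longrightarrow> X n \<in> borel_measurable (M n)"
  unfolding X_def using iid_sample.order_statistic_measurable[OF iid k_le] .

lemma X_sets:
  assumes "n \<ge> 1" "B \<in> sets borel"
  shows "{\<omega> \<in> space (M n). X n \<omega> \<in> B} \<in> sets (M n)"
  using measurable_sets[OF X_measurable[OF assms(1)] assms(2)]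
  by (simp add: vimage_def Int_def conj_commute)

lemma power_compl_pos: "0 < t ^ k n * (1 - t) ^ (n - k n)"
proof (cases "t = 1")
  case True
  then have "k n = n" unfolding k_def by simp
  with True show ?thesis by simp
qed (use t_pos t_le_1 in simp)

text \<open>Rank 0 gives the constant 0. For positive rank, \<open>F 0 = 0\<close> turns the change
  of measure to success probability \<open>1 / 2\<close> into the bound 0 for a nonpositive
  value.\<close>

lemma AE_X_nonneg:
  assumes "n \<ge> 1"
  shows "AE \<omega> in M n. X n \<omega> \<in> {0..}"
proof (cases "k n = 0")
  case True
  then show ?thesis by (simp add: X_def order_statistic_def)
next
  case False
  interpret iid_sample "M n" \<mu> n "T n" by (rule iid[OF assms])
  have "(1 / 2) ^ k n * (1 / 2) ^ (n - k n) * prob {\<omega> \<in> space (M n). X n \<omega> \<le> 0} \<le> 0"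
    using prob_order_statistic_le[of "k n" 0 "1 / 2"] False k_le[of n]
    by (simp add: measure_atMost F_0 X_def power_0_left)
  then have "\<not> 0 < prob {\<omega> \<in> space (M n). X n \<omega> \<le> 0}"
    by (metis half_gt_zero_iff mult_pos_pos not_le zero_less_one zero_less_power)
  then have "prob {\<omega> \<in> space (M n). X n \<omega> \<le> 0} = 0"
    by (simp add: zero_less_measure_iff)
  then have "AE \<omega> in M n. \<omega> \<notin> {\<omega> \<in> space (M n). X n \<omega> \<le> 0}"
    using X_sets[OF assms, of "{..0}"] by (subst (asm) prob_eq_0) auto
  then show ?thesis by (rule AE_mp) (auto intro!: AE_I2)
qed

lemma random_element_X: "n \<ge> 1 \<Longrightarrow> random_element (M n) (top_of_set {0..}) (X n)"
  unfolding random_element_def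
proof (intro conjI allI impI)
  assume n: "n \<ge> 1"
  show "prob_space (M n)" using iid[OF n] by (simp add: iid_sample_def)
  show "AE \<omega> in M n. X n \<omega> \<in> topspace (top_of_set {0..})" using AE_X_nonneg[OF n] by simp
  show "{\<omega> \<in> space (M n). X n \<omega> \<in> U} \<in> sets (M n)" if "openin (top_of_set {0..}) U" for U
  proof (rule X_sets[OF n])
    from that obtain V where "open V" "U = {0..} \<inter> V" by (auto simp: openin_open)
    then show "U \<in> sets borel" by simp
  qed
qed

lemma lower_tail:
  assumes c: "c < Finv t" and r: "ereal r < I_tilde Finv t c"
  shows "\<forall>\<^sub>F n in sequentially. measure (M n) {\<omega> \<in> space (M n). X n \<omega> \<le> c} \<le> exp (- (real n * r))"
proof -
  have t01: "t \<in> {0..1}" using t_pos t_le_1 by auto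
  have Fc: "F c < t"
  proof (cases "Finv 0 \<le> c")
    case True
    then have "F c < F (Finv t)"
      using c Finv_in[OF t01] by (intro strict_mono_onD[OF F_strict_mono]) auto
    then show ?thesis using F_Finv[OF t01] by simp
  next
    case False
    then show ?thesis using F_below[of c] t_pos by simp
  qed
  have bound: "\<forall>\<^sub>F n in sequentially.
      t ^ k n * (1 - t) ^ (n - k n) * measure (M n) {\<omega> \<in> space (M n). X n \<omega> \<le> c}
      \<le> F c ^ k n * (1 - F c) ^ (n - k n)"
    using eventually_k_ge_1
  proof eventually_elim
    case (elim n)
    interpret iid_sample "M n" \<mu> n "T n" using elim by (intro iid) auto
    show ?case
      using prob_order_statistic_le[of "k n" c t] elim k_le[of n] Fc t_le_1
      by (simp add: measure_atMost X_def)
  qed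
  show ?thesis
  \<comment> \<open>For \<open>F c = 0\<close> the rate is infinite and \<open>r\<close> is
    arbitrary; the right side of \<open>bound\<close> is 0 once \<open>k n \<ge> 1\<close>, so the
    probability vanishes.\<close>
  proof (cases "F c = 0")
    case True
    show ?thesis
      using bound eventually_k_ge_1
    proof eventually_elim
      case (elim n)
      then have "t ^ k n * (1 - t) ^ (n - k n) * measure (M n) {\<omega> \<in> space (M n). X n \<omega> \<le> c} \<le> 0"
        using True by (simp add: power_0_left)
      then have "measure (M n) {\<omega> \<in> space (M n). X n \<omega> \<le> c} \<le> 0"
        using power_compl_pos[of n] by (metis mult_pos_pos not_le)
      then show ?case by (rule order_trans) simp
    qed
  next
    case False
    then have "0 < F c" "F c < 1" using F_nonneg[of c] Fc t_le_1 by auto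
    moreover from this have "c \<in> {Finv 0..Finv 1}"
      using F_below[of c] F_above[of c] by force
    ultimately show ?thesis
      using bound r t_pos t_le_1 unfolding k_def
      by (intro eventually_le_exp_of_change_of_measure) (auto simp: I_tilde_eq)
  qed
qed

lemma upper_tail:
  assumes c: "Finv t < c" and r: "ereal r < I_tilde Finv t c"
  shows "\<forall>\<^sub>F n in sequentially. measure (M n) {\<omega> \<in> space (M n). c \<le> X n \<omega>} \<le> exp (- (real n * r))"
proof -
  have t01: "t \<in> {0..1}" using t_pos t_le_1 by auto
  have Fc: "t \<le> F c" using F_mono[of "Finv t" c] c F_Finv[OF t01] by simp
  show ?thesis
  \<comment> \<open>This covers every \<open>c\<close> beyond \<open>Finv 1\<close>, in particular
    all of the case \<open>t = 1\<close>; the sample then lies below \<open>c\<close> almost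
    surely.\<close>
  proof (cases "F c = 1")
    case True
    show ?thesis
      using eventually_k_ge_1
    proof eventually_elim
      case (elim n)
      interpret iid_sample "M n" \<mu> n "T n" using elim by (intro iid) auto
      show ?case
        using prob_order_statistic_ge_eq_0[of "k n" c] elim k_le[of n] True
        by (simp add: measure_lessThan X_def)
    qed
  next
    case False
    then have "0 < F c" "F c < 1" using F_le_1[of c] Fc t_pos by auto
    moreover from this have "c \<in> {Finv 0..Finv 1}"
      using F_below[of c] F_above[of c] by force
    moreover have "\<forall>\<^sub>F n in sequentially.
        t ^ k n * (1 - t) ^ (n - k n) * measure (M n) {\<omega> \<in> space (M n). c \<le> X n \<omega>}
        \<le> F c ^ k n * (1 - F c) ^ (n - k n)"
      using eventually_k_ge_1
    proof eventually_elim
      case (elim n)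
      interpret iid_sample "M n" \<mu> n "T n" using elim by (intro iid) auto
      show ?case
        using prob_order_statistic_ge[of "k n" t c] elim k_le[of n] Fc t_pos
        by (simp add: measure_lessThan X_def)
    qed
    ultimately show ?thesis
      using r t_pos t_le_1 unfolding k_def
      by (intro eventually_le_exp_of_change_of_measure) (auto simp: I_tilde_eq)
  qed
qed

text \<open>The rate vanishes at \<open>m = Finv t\<close>. If \<open>m\<close> is in
  \<open>C\<close>, the trivial bound 1 on probabilities suffices. Otherwise \<open>C\<close> is cut
  at \<open>m\<close>, and each piece lies in the tail that starts at its point nearest to
  \<open>m\<close>.\<close>

lemma upper_bound:
  assumes "closedin (top_of_set {0..}) C"
  shows "limsup (\<lambda>n. ereal (1 / real n) * log_prob (measure (M n) {\<omega> \<in> space (M n). X n \<omega> \<in> C}))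
      \<le> - (INF x\<in>C. I_tilde Finv t x)" (is "?L \<le> - ?J")
proof -
  have C: "closed C" using assms closedin_closed_trans closed_atLeast by blast
  then have C_borel: "C \<in> sets borel" by auto
  define m where "m = Finv t"
  have Im: "I_tilde Finv t m = 0"
    using t_pos t_le_1 Finv_in[of t] F_Finv[of t] by (auto simp: I_tilde_eq m_def I_rate_self)
  have "?L \<le> - ereal r" if r: "ereal r < ?J" for r
  proof (cases "m \<in> C")
    case True
    then have "?J \<le> 0" using Im by (metis INF_lower)
    then have "ereal r < 0" using r by (rule less_le_trans[rotated])
    then have "r \<le> 0" by simp
    have "measure (M n) {\<omega> \<in> space (M n). X n \<omega> \<in> C} \<le> exp (- (real n * r))" if "n \<ge> 1" for n
    proof -
      interpret iid_sample "M n" \<mu> n "T n" using that by (rule iid)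
      have "0 \<le> - (real n * r)" using \<open>r \<le> 0\<close> by (simp add: mult_nonneg_nonpos)
      then have "1 \<le> exp (- (real n * r))" by simp
      with prob_le_1 show ?thesis by (rule order_trans)
    qed
    then show ?thesis
      by (intro limsup_log_prob_le eventually_mono[OF eventually_ge_at_top[of 1]])
  next
    case False
    \<comment> \<open>The gap between \<open>r\<close> and \<open>r'\<close> later absorbs the
      factor 2 from adding the two tails.\<close>
    obtain r' where r': "ereal r < ereal r'" "ereal r' < ?J" using ereal_dense2[OF r] by blast
    have tail1: "\<forall>\<^sub>F n in sequentially.
        measure (M n) {\<omega> \<in> space (M n). X n \<omega> \<in> C \<inter> {..m}} \<le> exp (- (real n * r'))"
    proof (cases "C \<inter> {..m} = {}")
      case False
      \<comment> \<open>The nearest point to the left of \<open>m\<close> belongs to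
        \<open>C\<close> because \<open>C\<close> is closed, so its rate is at least the infimum
        over \<open>C\<close>.\<close>
      define c where "c = Sup (C \<inter> {..m})"
      have bdd: "bdd_above (C \<inter> {..m})" by auto
      have "c \<in> C \<inter> {..m}"
        unfolding c_def using False C bdd by (intro closed_contains_Sup) auto
      then have cC: "c \<in> C" "c < m" using \<open>m \<notin> C\<close> by (auto simp: less_le)
      have "ereal r' < I_tilde Finv t c" using r'(2) INF_lower[OF cC(1)] by (rule less_le_trans)
      from lower_tail[OF cC(2)[unfolded m_def] this] show ?thesis
        using eventually_ge_at_top[of 1]
      proof eventually_elim
        case (elim n)
        interpret iid_sample "M n" \<mu> n "T n" using elim by (intro iid)
        have "prob {\<omega> \<in> space (M n). X n \<omega> \<in> C \<inter> {..m}} \<le> prob {\<omega> \<in> space (M n). X n \<omega> \<le> c}"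
          using X_sets[OF elim(2), of "{..c}"] cSup_upper[OF _ bdd]
          by (intro finite_measure_mono) (auto simp: c_def)
        then show ?case using elim(1) by simp
      qed
    qed simp
    have tail2: "\<forall>\<^sub>F n in sequentially.
        measure (M n) {\<omega> \<in> space (M n). X n \<omega> \<in> C \<inter> {m..}} \<le> exp (- (real n * r'))"
    proof (cases "C \<inter> {m..} = {}")
      case False
      define c where "c = Inf (C \<inter> {m..})"
      have bdd: "bdd_below (C \<inter> {m..})" by auto
      have "c \<in> C \<inter> {m..}"
        unfolding c_def using False C bdd by (intro closed_contains_Inf) auto
      then have cC: "c \<in> C" "m < c" using \<open>m \<notin> C\<close> by (auto simp: less_le)
      have "ereal r' < I_tilde Finv t c" using r'(2) INF_lower[OF cC(1)] by (rule less_le_trans)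
      from upper_tail[OF cC(2)[unfolded m_def] this] show ?thesis
        using eventually_ge_at_top[of 1]
      proof eventually_elim
        case (elim n)
        interpret iid_sample "M n" \<mu> n "T n" using elim by (intro iid)
        have "prob {\<omega> \<in> space (M n). X n \<omega> \<in> C \<inter> {m..}} \<le> prob {\<omega> \<in> space (M n). c \<le> X n \<omega>}"
          using X_sets[OF elim(2), of "{c..}"] cInf_lower[OF _ bdd]
          by (intro finite_measure_mono) (auto simp: c_def)
        then show ?case using elim(1) by simp
      qed
    qed simp
    have "filterlim (\<lambda>n. real n * (r' - r)) at_top sequentially"
      by (rule filterlim_at_top_mult_tendsto_pos[OF tendsto_const _ filterlim_real_sequentially]) (use r' in simp)
    then have "\<forall>\<^sub>F n in sequentially. ln 2 \<le> real n * (r' - r)"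
      by (simp add: filterlim_at_top)
    then have "\<forall>\<^sub>F n in sequentially.
        measure (M n) {\<omega> \<in> space (M n). X n \<omega> \<in> C} \<le> exp (- (real n * r))"
      using tail1 tail2 eventually_ge_at_top[of 1]
    proof eventually_elim
      case (elim n)
      interpret iid_sample "M n" \<mu> n "T n" using elim by (intro iid)
      have "{\<omega> \<in> space (M n). X n \<omega> \<in> C} = {\<omega> \<in> space (M n). X n \<omega> \<in> C \<inter> {..m}}
          \<union> {\<omega> \<in> space (M n). X n \<omega> \<in> C \<inter> {m..}}" by auto
      also have "prob \<dots> \<le> prob {\<omega> \<in> space (M n). X n \<omega> \<in> C \<inter> {..m}}
          + prob {\<omega> \<in> space (M n). X n \<omega> \<in> C \<inter> {m..}}"
        using elim(4) C_borel by (intro measure_Un_le X_sets) auto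
      also have "\<dots> \<le> 2 * exp (- (real n * r'))" using elim by simp
      also have "\<dots> = exp (ln 2 - real n * r')" by (simp add: exp_diff exp_minus field_simps)
      also have "\<dots> \<le> exp (- (real n * r))" using elim(1) by (simp add: algebra_simps)
      finally show ?case .
    qed
    then show ?thesis by (rule limsup_log_prob_le)
  qed
  note L_le = this
  show ?thesis
  proof (rule ccontr)
    assume "\<not> ?L \<le> - ?J"
    then have "- ?J < ?L" by (rule not_le_imp_less)
    then have "- ?L < ?J" by (rule iffD1[OF ereal_uminus_less_reorder])
    from ereal_dense2[OF this] obtain r where r: "- ?L < ereal r" "ereal r < ?J" by blast
    from r(1) have "- ereal r < ?L" by (rule iffD1[OF ereal_uminus_less_reorder])
    with L_le[OF r(2)] show False by (rule leD[THEN notE])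
  qed
qed

text \<open>It suffices to treat each \<open>y\<close> in \<open>G\<close> of finite rate
  separately. Openness supplies an interval \<open>{u<..y}\<close> inside \<open>G\<close>, and its
  probability already decays with rate at most \<open>I_rate t (F y)\<close>.\<close>

lemma lower_bound:
  assumes "openin (top_of_set {0..}) G"
  shows "- (INF x\<in>G. I_tilde Finv t x)
      \<le> liminf (\<lambda>n. ereal (1 / real n) * log_prob (measure (M n) {\<omega> \<in> space (M n). X n \<omega> \<in> G}))"
    (is "_ \<le> ?L")
proof -
  obtain V where V: "open V" "G = {0..} \<inter> V" using assms by (auto simp: openin_open)
  have G_borel: "G \<in> sets borel" unfolding V(2) using V(1) by auto
  have *: "- I_tilde Finv t y \<le> ?L" if y: "y \<in> G" for y
  proof (cases "I_tilde Finv t y = \<infinity>")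
    case False
    then have yab: "y \<in> {Finv 0..Finv 1}" and Iy: "I_tilde Finv t y = I_rate t (F y)"
      by (auto simp: I_tilde_eq split: if_splits)
    have x0: "F y \<noteq> 0" using False I_rate_0[OF t_pos] unfolding Iy by metis
    have x1: "F y < 1 \<or> t = 1"
      using False I_rate_1[of t] F_le_1[of y] unfolding Iy by (metis less_le)
    have xpos: "0 < F y" using x0 F_nonneg[of y] by simp
    have "Finv 0 \<noteq> y" using x0 F_below[of y] by auto
    then have ylt: "Finv 0 < y" using yab by auto
    obtain e where e: "0 < e" "ball y e \<subseteq> V" using V y by (auto simp: open_contains_ball)
    \<comment> \<open>\<open>y - e / 2\<close> keeps \<open>{u<..y}\<close> within the ball, and
      \<open>Finv 0\<close> keeps \<open>u\<close> nonnegative and in the range where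
      \<open>F\<close> is strictly increasing.\<close>
    define u where "u = max (Finv 0) (y - e / 2)"
    have u: "u < y" "Finv 0 \<le> u" "0 \<le> u" "y - e < u"
      using ylt e(1) Finv_nonneg[of 0] by (auto simp: u_def)
    have Fu: "F u < F y" using u yab by (intro strict_mono_onD[OF F_strict_mono]) auto
    have sub: "{u<..y} \<subseteq> G"
      using u e by (auto simp: V(2) dist_real_def intro!: subsetD[OF e(2)])
    \<comment> \<open>As \<open>F u / F y < 1\<close>, its powers with exponent at least 1 are at
      most \<open>F u / F y\<close>; hence \<open>F y ^ k n - F u ^ k n\<close> is at least
      \<open>c * F y ^ k n\<close>, with \<open>c\<close> independent of \<open>n\<close>.\<close>
    define c where "c = 1 - F u / F y"
    have "0 < c" using Fu xpos by (simp add: c_def)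
    have "\<forall>\<^sub>F n in sequentially. real (n choose k n) * (c * F y ^ k n) * (1 - F y) ^ (n - k n)
        \<le> measure (M n) {\<omega> \<in> space (M n). X n \<omega> \<in> G}"
      using eventually_k_ge_1
    proof eventually_elim
      case (elim n)
      then have n: "1 \<le> n" by simp
      interpret iid_sample "M n" \<mu> n "T n" using n by (rule iid)
      have "(F u / F y) ^ k n \<le> (F u / F y) ^ 1"
        using elim Fu xpos F_nonneg[of u] by (intro power_decreasing) auto
      then have "c * F y ^ k n \<le> (1 - (F u / F y) ^ k n) * F y ^ k n"
        using xpos by (intro mult_right_mono) (auto simp: c_def)
      also have "\<dots> = F y ^ k n - F u ^ k n" using xpos by (simp add: field_simps)
      finally have "real (n choose k n) * (c * F y ^ k n) * (1 - F y) ^ (n - k n)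
          \<le> real (n choose k n) * (F y ^ k n - F u ^ k n) * (1 - F y) ^ (n - k n)"
        using F_le_1[of y] by (intro mult_right_mono mult_left_mono) auto
      also have "\<dots> \<le> prob {\<omega> \<in> space (M n). u < X n \<omega> \<and> X n \<omega> \<le> y}"
        using prob_order_statistic_interval_ge[of "k n" u y] elim k_le[of n] u(1)
        by (simp add: measure_atMost X_def)
      also have "\<dots> \<le> prob {\<omega> \<in> space (M n). X n \<omega> \<in> G}"
        using sub X_sets[OF n G_borel] by (intro finite_measure_mono) auto
      finally show ?case .
    qed
    then show ?thesis
      unfolding Iy k_def
      using t_pos t_le_1 xpos F_le_1[of y] x1 \<open>0 < c\<close>
      by (intro liminf_log_prob_ge_binomial[where c = c]) auto
  qed simp
  have "- ?L \<le> I_tilde Finv t y" if "y \<in> G" for y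
    using *[OF that] by (rule iffD1[OF ereal_uminus_le_reorder])
  then have "- ?L \<le> (INF x\<in>G. I_tilde Finv t x)" by (rule INF_greatest)
  then show ?thesis by (rule iffD1[OF ereal_uminus_le_reorder])
qed

lemma satisfies_LDP_X: "satisfies_LDP M (top_of_set {0..}) X (I_tilde Finv t)"
  unfolding satisfies_LDP_def
  using rate_function_I_tilde random_element_X lower_bound upper_bound by blast

end

text \<open>The value \<open>t = 0\<close> has to be excluded: there the statistic is constantly 0,
  while \<open>I_tilde Finv 0 y\<close> equals \<open>- ln (1 - F y)\<close>, which is finite for
  \<open>y\<close> between \<open>Finv 0\<close> and \<open>Finv 1\<close>, so the lower bound fails
  on open intervals there.\<close>

theorem corollary3p1:
  fixes t :: real
    and F Finv :: "real \<Rightarrow> real"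
    and M :: "nat \<Rightarrow> 'a measure"
    and T :: "nat \<Rightarrow> nat \<Rightarrow> 'a \<Rightarrow> real"
  assumes "t \<in> {0..1}" and "t \<noteq> 0"
    and "abs_cont_distribution_function F"
    and "\<And>x. x < 0 \<Longrightarrow> F x = 0"
    and "strictly_increasing_with_inverse F Finv"
    and "\<And>n. n \<ge> 1 \<Longrightarrow> prob_space (M n)"
    and "\<And>n. n \<ge> 1 \<Longrightarrow> prob_space.indep_vars (M n) (\<lambda>_. borel) (T n) {1..n}"
    and "\<And>n i. n \<ge> 1 \<Longrightarrow> i \<in> {1..n} \<Longrightarrow> cdf (distr (M n) borel (T n i)) = F"
  shows "satisfies_LDP M (top_of_set {0..})
           (\<lambda>n \<omega>. order_statistic n (\<lambda>i. T n i \<omega>) (nat \<lfloor>real n * t\<rfloor>))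
           (I_tilde Finv t)
       \<and> good_rate_function (top_of_set {0..}) (I_tilde Finv t)"
proof -
  obtain \<mu> where \<mu>: "real_distribution \<mu>" "absolutely_continuous lborel \<mu>" "F = cdf \<mu>"
    using assms(3) by (auto simp: abs_cont_distribution_function_def)
  have no_atoms: "measure \<mu> {x} = 0" for x
  proof -
    have "{x} \<in> null_sets \<mu>"
      using \<mu>(2) by (rule subsetD[OF absolutely_continuous_def[THEN iffD1]]) (simp add: finite_imp_null_set_lborel)
    then show ?thesis by (simp add: measure_eq_0_null_sets)
  qed
  have iid: "iid_sample (M n) \<mu> n (T n)" if n: "n \<ge> 1" for n
  proof -
    interpret prob_space "M n" using n by (rule assms(6))
    have "distr (M n) borel (T n i) = \<mu>" if i: "i \<in> {1..n}" for i
    proof (rule cdf_unique)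
      have "T n i \<in> borel_measurable (M n)"
        using assms(7)[OF n] i by (simp add: indep_vars_def)
      then show "real_distribution (distr (M n) borel (T n i))"
        by (rule real_distribution_distr)
    qed (use \<mu> assms(8)[OF n i] in auto)
    then show ?thesis
      using n assms(7)[OF n] by unfold_locales auto
  qed
  interpret order_statistic_LDP F Finv \<mu> t M T
  proof (intro order_statistic_LDP.intro continuous_quantile.intro order_statistic_LDP_axioms.intro)
    show "0 < t" "t \<le> 1" using assms(1,2) by auto
  qed (fact \<mu> no_atoms assms(4,5) iid)+
  show ?thesis
    using satisfies_LDP_X good_rate_function_I_tilde unfolding X_def k_def by (rule conjI)
qed

end
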